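(* Let $N=(P,S)$ be a rigid translational spring network in dimension $2$ with $n$ nodes $p_1,\dots,p_n$ and $s$ linear springs, and let $d(p_j)$ denote the number of springs incident to the node $p_j$. Let $B_f$ be the Bézout bound of the standard system of $N$ and let $B_i$ be the Bézout bound of the inverse-length system of $N$. Then $$B_f = 2^s \prod_{j=1}^n \left(1+d(p_j)\right)^2 \le 2^s\left(1+\frac{2s}{n}\right)^{2n},$$ and $$B_i = 4^s 4^n = 2^{2s+2n}.$$
   Context: A translational spring network is a pair $N=(P,S)$ consisting of a finite set of nodes $P=\{p_1,\dots,p_n\}$, $n\ge 2$, and a set of springs $S\subseteq\{s_{i,j}: 1\le i<j\le n\}$, where $s_{i,j}$ connects $p_i$ and $p_j$. The notation is symmetric: $s_{j,i}=s_{i,j}$, and likewise for all quantities indexed by springs. Each spring $s_{i,j}\in S$ comes with a spring constant $k_{i,j}>0$ and a resting length $\tilde\ell_{i,j}>0$ (known real parameters). An embedding of $N$ into $\mathbb{R}^2$ assigns to each $p_i$ a point $(x_i,y_i)\in\mathbb{R}^2$, and this determines the stretched lengths $\ell_{i,j}$ as the Euclidean distances between the points assigned to $p_i$ and $p_j$. By Hooke's law, the spring $s_{i,j}$ exerts on $p_i$ the force $k_{i,j}(\ell_{i,j}-\tilde\ell_{i,j})\frac{1}{\ell_{i,j}}(x_j-x_i,\,y_j-y_i)$ (defined when $\ell_{i,j}\neq 0$). An embedding is an equilibrium position if for every node the net force from all incident springs is defined and equal to $0$. The network is rigid (in dimension $2$) if it has finitely many equilibrium positions up to rotations and translations. The standard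 system of $N$ is the following system of $s+2n$ polynomials (set equal to $0$) in the $s+2n$ variables $x_1,\dots,x_n,y_1,\dots,y_n$ and $\ell_{i,j}$ ($s_{i,j}\in S$): (1) for each $s_{i,j}\in S$, the geometric equation $(x_j-x_i)^2+(y_j-y_i)^2-\ell_{i,j}^2=0$; (2) for each node $p_i$, the two force equations $$\sum_{j:\,s_{i,j}\in S} k_{i,j}(\ell_{i,j}-\tilde\ell_{i,j})(x_j-x_i)\prod_{m\ne j:\, s_{i,m}\in S}\ell_{i,m}=0,\qquad \sum_{j:\,s_{i,j}\in S} k_{i,j}(\ell_{i,j}-\tilde\ell_{i,j})(y_j-y_i)\prod_{m\ne j:\, s_{i,m}\in S}\ell_{i,m}=0.$$ The inverse-length system of $N$ is the following system of $s+2n$ polynomials in the variables $x_1,\dots,x_n,y_1,\dots,y_n$ and $I_{i,j}$ ($s_{i,j}\in S$), where $I_{i,j}$ represents $1/\ell_{i,j}$: (1) for each $s_{i,j}\in S$, the geometric equation $\left((x_j-x_i)^2+(y_j-y_i)^2\right)I_{i,j}^2-1=0$; (2) for each node $p_i$, the two force equations $$\sum_{j:\,s_{i,j}\in S} k_{i,j}(1-\tilde\ell_{i,j}I_{i,j})(x_j-x_i)=0,\qquad \sum_{j:\,s_{i,j}\in S} k_{i,j}(1-\tilde\ell_{i,j}I_{i,j})(y_j-y_i)=0.$$ The Bézout bound of a system of polynomial equations is the product of the total degrees (in the variables, not the parameters) of all polynomials in the system. Here both systems include all force equations for all nodes; no coordinate frame has been fixed. *)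

theory Defs
  imports "HOL-Analysis.Analysis" "HOL-Library.Poly_Mapping" "HOL-Library.Multiset"
begin

text \<open>
  A network with nodes \<open>p\<^sub>1, \<dots>, p\<^sub>n\<close> has node labels \<open>1, \<dots>, n\<close>. A spring \<open>s\<^sub>i\<^sub>,\<^sub>j\<close> is the unordered
  pair \<open>{i, j}\<close>, so every quantity indexed by springs is symmetric in \<open>i, j\<close> by construction.
  \<open>k\<close> gives the spring constants and \<open>r\<close> the resting lengths; only their values on \<open>S\<close> matter.
\<close>

definition spring_network ::
  "nat \<Rightarrow> nat set set \<Rightarrow> (nat set \<Rightarrow> real) \<Rightarrow> (nat set \<Rightarrow> real) \<Rightarrow> bool" where
  "spring_network n S k r \<longleftrightarrow>
     2 \<le> n \<and> S \<subseteq> {{i, j} | i j. 1 \<le> i \<and> i < j \<and> j \<le> n} \<and> (\<forall>e\<in>S. 0 < k e \<and> 0 < r e)"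

definition neighbours :: "nat set set \<Rightarrow> nat \<Rightarrow> nat set" where
  "neighbours S i = {j. {i, j} \<in> S}"

definition num_incident :: "nat set set \<Rightarrow> nat \<Rightarrow> nat" where
  "num_incident S i = card {e \<in> S. i \<in> e}"


section \<open>Equilibria and rigidity in the plane\<close>

text \<open>Only meaningful for \<open>p i \<noteq> p j\<close>, which \<open>equilibria\<close> requires separately.\<close>

definition spring_force ::
  "(nat set \<Rightarrow> real) \<Rightarrow> (nat set \<Rightarrow> real) \<Rightarrow> (nat \<Rightarrow> real^2) \<Rightarrow> nat \<Rightarrow> nat \<Rightarrow> real^2" where
  "spring_force k r p i j =
     (k {i, j} * (dist (p i) (p j) - r {i, j}) * (1 / dist (p i) (p j))) *\<^sub>R (p j - p i)"

text \<open>An embedding is a function on \<open>{1..n}\<close>, made extensional so that distinct embeddings differ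
  at some node.\<close>

definition equilibria ::
  "nat \<Rightarrow> nat set set \<Rightarrow> (nat set \<Rightarrow> real) \<Rightarrow> (nat set \<Rightarrow> real) \<Rightarrow> (nat \<Rightarrow> real^2) set" where
  "equilibria n S k r =
     {p \<in> {1..n} \<rightarrow>\<^sub>E UNIV. \<forall>i\<in>{1..n}.
        (\<forall>j\<in>neighbours S i. dist (p i) (p j) \<noteq> 0) \<and>
        (\<Sum>j\<in>neighbours S i. spring_force k r p i j) = 0}"

definition rigid_motion_rel :: "nat \<Rightarrow> ((nat \<Rightarrow> real^2) \<times> (nat \<Rightarrow> real^2)) set" where
  "rigid_motion_rel n =
     {(p, q). \<exists>(A::real^2^2) t. rotation_matrix A \<and> (\<forall>i\<in>{1..n}. q i = A *v p i + t)}"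

definition rigid_network ::
  "nat \<Rightarrow> nat set set \<Rightarrow> (nat set \<Rightarrow> real) \<Rightarrow> (nat set \<Rightarrow> real) \<Rightarrow> bool" where
  "rigid_network n S k r \<longleftrightarrow>
     finite (equilibria n S k r //
       (rigid_motion_rel n \<inter> equilibria n S k r \<times> equilibria n S k r))"


section \<open>Multivariate polynomials and the Bezout bound\<close>

text \<open>A polynomial is a finitely supported map from monomials to coefficients, a monomial a finitely
  supported map from variables to exponents; the ring operations are those of
  \<^theory>\<open>HOL-Library.Poly_Mapping\<close>.\<close>

type_synonym 'v mpoly = "('v \<Rightarrow>\<^sub>0 nat) \<Rightarrow>\<^sub>0 real"

definition var :: "'v \<Rightarrow> 'v mpoly" where
  "var v = Poly_Mapping.single (Poly_Mapping.single v 1) 1"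

definition const :: "real \<Rightarrow> 'v mpoly" where
  "const c = Poly_Mapping.single 0 c"

definition monom_degree :: "('v \<Rightarrow>\<^sub>0 nat) \<Rightarrow> nat" where
  "monom_degree m = (\<Sum>v\<in>Poly_Mapping.keys m. Poly_Mapping.lookup m v)"

text \<open>The zero polynomial has total degree \<open>0\<close> by convention.\<close>

definition total_degree :: "'v mpoly \<Rightarrow> nat" where
  "total_degree f = Max (insert 0 (monom_degree ` Poly_Mapping.keys f))"

text \<open>A system is a multiset, since the same polynomial may arise as two different equations and
  then counts twice.\<close>

definition bezout_bound :: "'v mpoly multiset \<Rightarrow> nat" where
  "bezout_bound F = (\<Prod>f\<in>#F. total_degree f)"


section \<open>The two polynomial systems\<close>

text \<open>\<open>Len e\<close> stands for the stretched length of \<open>e\<close> and \<open>Inv e\<close> for its inverse. The standard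
  system only involves \<open>X\<close>, \<open>Y\<close>, \<open>Len\<close> and the inverse-length system only \<open>X\<close>, \<open>Y\<close>, \<open>Inv\<close>.\<close>

datatype variable = X nat | Y nat | Len "nat set" | Inv "nat set"

definition sq_dist_poly :: "nat \<Rightarrow> nat \<Rightarrow> variable mpoly" where
  "sq_dist_poly i j = (var (X j) - var (X i))\<^sup>2 + (var (Y j) - var (Y i))\<^sup>2"

definition ordered_springs :: "nat set set \<Rightarrow> (nat \<times> nat) set" where
  "ordered_springs S = {(i, j). i < j \<and> {i, j} \<in> S}"

text \<open>In the force polynomials the argument \<open>C\<close> is \<open>X\<close> or \<open>Y\<close>, selecting the coordinate.\<close>

definition standard_force ::
  "nat set set \<Rightarrow> (nat set \<Rightarrow> real) \<Rightarrow> (nat set \<Rightarrow> real) \<Rightarrow> (nat \<Rightarrow> variable) \<Rightarrow> nat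
    \<Rightarrow> variable mpoly" where
  "standard_force S k r C i =
     (\<Sum>j\<in>neighbours S i.
        const (k {i, j}) * (var (Len {i, j}) - const (r {i, j})) * (var (C j) - var (C i)) *
        (\<Prod>m\<in>neighbours S i - {j}. var (Len {i, m})))"

definition standard_system ::
  "nat \<Rightarrow> nat set set \<Rightarrow> (nat set \<Rightarrow> real) \<Rightarrow> (nat set \<Rightarrow> real) \<Rightarrow> variable mpoly multiset" where
  "standard_system n S k r =
     {# sq_dist_poly i j - (var (Len {i, j}))\<^sup>2. (i, j) \<in># mset_set (ordered_springs S) #} +
     {# standard_force S k r X i. i \<in># mset_set {1..n} #} +
     {# standard_force S k r Y i. i \<in># mset_set {1..n} #}"

definition inverse_force ::
  "nat set set \<Rightarrow> (nat set \<Rightarrow> real) \<Rightarrow> (nat set \<Rightarrow> real) \<Rightarrow> (nat \<Rightarrow> variable) \<Rightarrow> nat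
    \<Rightarrow> variable mpoly" where
  "inverse_force S k r C i =
     (\<Sum>j\<in>neighbours S i.
        const (k {i, j}) * (1 - const (r {i, j}) * var (Inv {i, j})) * (var (C j) - var (C i)))"

definition inverse_length_system ::
  "nat \<Rightarrow> nat set set \<Rightarrow> (nat set \<Rightarrow> real) \<Rightarrow> (nat set \<Rightarrow> real) \<Rightarrow> variable mpoly multiset" where
  "inverse_length_system n S k r =
     {# sq_dist_poly i j * (var (Inv {i, j}))\<^sup>2 - 1. (i, j) \<in># mset_set (ordered_springs S) #} +
     {# inverse_force S k r X i. i \<in># mset_set {1..n} #} +
     {# inverse_force S k r Y i. i \<in># mset_set {1..n} #}"

end

theory Submission
  imports Defs "HOL-Computational_Algebra.Polynomial"
begin

text \<open>
  The degrees of the force equations are as large as they look only at nodes that carry a spring: at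
  an isolated node both force polynomials vanish. Rigidity excludes isolated nodes, but only because
  equilibria exist at all (no equilibria would also be finitely many). Any minimiser of
  the spring energy \<open>\<Sum>k(\<ell> - r)\<^sup>2\<close> is an equilibrium: a spring of length zero could be stretched with a gain of first
  order, so every spring has positive length at a minimiser and the energy is differentiable there.
  Moving an isolated node of an equilibrium then gives infinitely many inequivalent ones, distinguished
  by the distance of that node to another one.

  Lower bounds for total degrees come from restricting a polynomial to a line through the origin on
  which its top homogeneous part does not vanish. The estimate of the product is the inequality of
  arithmetic and geometric means together with \<open>\<Sum>d(p\<^sub>j) = 2s\<close>.
\<close>


section \<open>Total degrees\<close>

lemma monom_degree_add: "monom_degree (a + b) = monom_degree a + monom_degree b"
  unfolding monom_degree_def by (rule setsum_keys_plus_distrib) auto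

lemma monom_degree_0 [simp]: "monom_degree 0 = 0"
  by (simp add: monom_degree_def)

lemma monom_degree_le_total: "m \<in> Poly_Mapping.keys f \<Longrightarrow> monom_degree m \<le> total_degree f"
  unfolding total_degree_def by (intro Max_ge) auto

lemma total_degree_leI:
  "(\<And>m. m \<in> Poly_Mapping.keys f \<Longrightarrow> monom_degree m \<le> d) \<Longrightarrow> total_degree f \<le> d"
  unfolding total_degree_def by (subst Max_le_iff) auto

lemma total_degree_0 [simp]: "total_degree 0 = 0"
  by (simp add: total_degree_def)

lemma total_degree_1 [simp]: "total_degree 1 = 0"
  by (simp add: total_degree_def)

lemma total_degree_const [simp]: "total_degree (const c) = 0"
  by (simp add: total_degree_def const_def)

lemma total_degree_var [simp]: "total_degree (var v) = 1"
  by (simp add: total_degree_def var_def monom_degree_def)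

text \<open>The bound is a free \<open>d\<close> instead of a maximum, so that this and the
  following rules chain along the shape of a polynomial.\<close>

lemma total_degree_add_le:
  assumes "total_degree f \<le> d" "total_degree g \<le> d"
  shows "total_degree (f + g) \<le> d"
proof (rule total_degree_leI)
  fix m assume "m \<in> Poly_Mapping.keys (f + g)"
  then have "m \<in> Poly_Mapping.keys f \<or> m \<in> Poly_Mapping.keys g"
    using keys_add[of f g] by blast
  then show "monom_degree m \<le> d"
    using assms by (auto dest: monom_degree_le_total)
qed

lemma total_degree_diff_le:
  assumes "total_degree f \<le> d" "total_degree g \<le> d"
  shows "total_degree (f - g) \<le> d"
proof (rule total_degree_leI)
  fix m assume "m \<in> Poly_Mapping.keys (f - g)"
  then have "m \<in> Poly_Mapping.keys f \<or> m \<in> Poly_Mapping.keys g"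
    by (auto simp: in_keys_iff lookup_minus)
  then show "monom_degree m \<le> d"
    using assms by (auto dest: monom_degree_le_total)
qed

lemma total_degree_mult_le:
  assumes "total_degree f \<le> d" "total_degree g \<le> e"
  shows "total_degree (f * g) \<le> d + e"
proof (rule total_degree_leI)
  fix m assume "m \<in> Poly_Mapping.keys (f * g)"
  then obtain a b where "m = a + b" "a \<in> Poly_Mapping.keys f" "b \<in> Poly_Mapping.keys g"
    using keys_mult[of f g] by blast
  then show "monom_degree m \<le> d + e"
    using assms by (auto simp: monom_degree_add dest!: monom_degree_le_total)
qed

lemma total_degree_power2_le:
  "total_degree f \<le> d \<Longrightarrow> total_degree (f\<^sup>2) \<le> 2 * d"
  using total_degree_mult_le[of f d f d] by (simp add: power2_eq_square)

lemma total_degree_sum_le: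
  "(\<And>i. i \<in> A \<Longrightarrow> total_degree (f i) \<le> d) \<Longrightarrow> total_degree (\<Sum>i\<in>A. f i) \<le> d"
  by (induction A rule: infinite_finite_induct) (auto intro: total_degree_add_le)

lemma total_degree_prod_le:
  "(\<And>i. i \<in> A \<Longrightarrow> total_degree (f i) \<le> 1) \<Longrightarrow> total_degree (\<Prod>i\<in>A. f i) \<le> card A"
proof (induction A rule: infinite_finite_induct)
  case (insert x A)
  then show ?case
    using total_degree_mult_le[of "f x" 1 "prod f A" "card A"] by simp
qed auto

section \<open>Restriction of polynomials to lines through the origin\<close>

text \<open>Adding one term at a time suits additive maps: it reduces their multiplicativity to
  monomials.\<close>

lemma mpoly_induct [case_names zero add]:
  fixes f :: "'v mpoly"
  assumes "P 0" "\<And>f m c. P f \<Longrightarrow> P (Poly_Mapping.single m c + f)"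
  shows "P f"
proof (induction f rule: update_induct)
  case const
  then show ?case by (simp add: assms(1))
next
  case (update f a b)
  have "Poly_Mapping.update a b f = Poly_Mapping.single a b + f"
    using update(1)
    by (intro poly_mapping_eqI)
      (auto simp: lookup_update lookup_add lookup_single when_def in_keys_iff)
  with assms(2) update show ?case by metis
qed

definition monom_value :: "('v \<Rightarrow> real) \<Rightarrow> ('v \<Rightarrow>\<^sub>0 nat) \<Rightarrow> real" where
  "monom_value c m = (\<Prod>v\<in>Poly_Mapping.keys m. c v ^ Poly_Mapping.lookup m v)"

text \<open>Surplus variables have exponent 0 and contribute a factor 1, so several monomials can
  share one index set.\<close>

lemma monom_value_superset:
  assumes "finite A" "Poly_Mapping.keys m \<subseteq> A"
  shows "monom_value c m = (\<Prod>v\<in>A. c v ^ Poly_Mapping.lookup m v)"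
  unfolding monom_value_def using assms
  by (intro prod.mono_neutral_left) (auto simp: in_keys_iff)

lemma monom_value_add: "monom_value c (a + b) = monom_value c a * monom_value c b"
proof -
  let ?A = "Poly_Mapping.keys a \<union> Poly_Mapping.keys b"
  have "monom_value c x = (\<Prod>v\<in>?A. c v ^ Poly_Mapping.lookup x v)" if "x \<in> {a, b, a + b}" for x
    using that keys_add[of a b] by (intro monom_value_superset) auto
  then show ?thesis
    by (simp add: lookup_add power_add prod.distrib)
qed

text \<open>Restriction of a polynomial to the line \<open>x \<mapsto> x \<cdot> c\<close>, as a polynomial in \<open>x\<close>.\<close>

definition line_poly :: "('v \<Rightarrow> real) \<Rightarrow> 'v mpoly \<Rightarrow> real poly" where
  "line_poly c f =
    (\<Sum>m\<in>Poly_Mapping.keys f. monom (Poly_Mapping.lookup f m * monom_value c m) (monom_degree m))"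

text \<open>The coefficient of \<open>line_poly c f\<close> at exponent d is the value at
  \<open>c\<close> of the homogeneous part of degree d, so the degree may drop but never
  grow.\<close>

lemma degree_line_poly_le: "degree (line_poly c f) \<le> total_degree f"
  unfolding line_poly_def
  by (intro degree_sum_le) (auto intro: order.trans[OF degree_monom_le] monom_degree_le_total)

lemma line_poly_0 [simp]: "line_poly c 0 = 0"
  by (simp add: line_poly_def)

lemma line_poly_add [simp]: "line_poly c (f + g) = line_poly c f + line_poly c g"
  unfolding line_poly_def
  by (rule setsum_keys_plus_distrib) (auto simp: add_monom algebra_simps)

lemma line_poly_diff [simp]: "line_poly c (f - g) = line_poly c f - line_poly c g"
  using line_poly_add[of c "f - g" g] by (simp add: algebra_simps)

lemma line_poly_single:
  "line_poly c (Poly_Mapping.single m a) = monom (a * monom_value c m) (monom_degree m)"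
  by (simp add: line_poly_def)

lemma line_poly_mult [simp]: "line_poly c (f * g) = line_poly c f * line_poly c g"
proof (induction f rule: mpoly_induct)
  case (add f m a)
  have "line_poly c (Poly_Mapping.single m a * g) = line_poly c (Poly_Mapping.single m a) * line_poly c g"
    by (induction g rule: mpoly_induct)
      (simp_all add: distrib_left mult_single line_poly_single mult_monom monom_value_add monom_degree_add mult_ac)
  with add show ?case by (simp add: distrib_right)
qed simp

lemma line_poly_1 [simp]: "line_poly c 1 = 1"
  using line_poly_single[of c 0 1] by (simp add: monom_value_def)

lemma line_poly_const [simp]: "line_poly c (const a) = [:a:]"
  by (simp add: const_def line_poly_single monom_value_def monom_0)

lemma line_poly_var [simp]: "line_poly c (var v) = [:0, c v:]"
  by (simp add: var_def line_poly_single monom_value_def monom_degree_def monom_Suc monom_0)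

lemma line_poly_sum [simp]: "line_poly c (\<Sum>i\<in>A. f i) = (\<Sum>i\<in>A. line_poly c (f i))"
  by (induction A rule: infinite_finite_induct) simp_all

lemma line_poly_prod [simp]: "line_poly c (\<Prod>i\<in>A. f i) = (\<Prod>i\<in>A. line_poly c (f i))"
  by (induction A rule: infinite_finite_induct) simp_all

lemma total_degree_eqI:
  "total_degree f \<le> d \<Longrightarrow> degree (line_poly c f) = d \<Longrightarrow> total_degree f = d"
  using degree_line_poly_le[of c f] by simp


section \<open>Degrees of the equations\<close>

lemma total_degree_sq_dist_le: "total_degree (sq_dist_poly i j) \<le> 2"
  unfolding sq_dist_poly_def
  by (intro total_degree_add_le total_degree_power2_le[where d = 1, simplified]
    total_degree_diff_le) simp_all

lemma total_degree_standard_geometric: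
  assumes "i \<noteq> j"
  shows "total_degree (sq_dist_poly i j - (var (Len e))\<^sup>2) = 2"
\<comment> \<open>In this direction the polynomial becomes x^2.\<close>
proof (rule total_degree_eqI[where c = "\<lambda>v. if v = X j then 1 else 0"])
  show "total_degree (sq_dist_poly i j - (var (Len e))\<^sup>2) \<le> 2"
    by (intro total_degree_diff_le total_degree_sq_dist_le
      total_degree_power2_le[where d = 1, simplified]) simp
qed (use assms in \<open>simp add: sq_dist_poly_def power2_eq_square\<close>)

lemma total_degree_inverse_geometric:
  assumes "i \<noteq> j"
  shows "total_degree (sq_dist_poly i j * (var (Inv e))\<^sup>2 - 1) = 4"
\<comment> \<open>In this direction the polynomial becomes x^4 - 1.\<close>
proof (rule total_degree_eqI[where c = "\<lambda>v. if v = X j \<or> v = Inv e then 1 else 0"])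
  have "total_degree (sq_dist_poly i j * (var (Inv e))\<^sup>2) \<le> 2 + 2"
    by (intro total_degree_mult_le total_degree_sq_dist_le
      total_degree_power2_le[where d = 1, simplified]) simp
  then show "total_degree (sq_dist_poly i j * (var (Inv e))\<^sup>2 - 1) \<le> 4"
    by (intro total_degree_diff_le) simp_all
qed (use assms in \<open>simp add: sq_dist_poly_def power2_eq_square one_pCons\<close>)

lemma total_degree_standard_force:
  assumes fin: "finite (neighbours S i)" and ne: "j \<in> neighbours S i" and "j \<noteq> i"
    and k: "k {i, j} \<noteq> 0" and C: "C \<in> {X, Y}"
  shows "total_degree (standard_force S k r C i) = 1 + card (neighbours S i)"
\<comment> \<open>All lengths and the coordinate of \<open>j\<close> become x, the other coordinates
  0. Only the summand of \<open>j\<close> survives, namely k (x - r) x^d with d the number of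
  neighbours.\<close>
proof (rule total_degree_eqI[where c = "\<lambda>v. if v = C j \<or> v \<in> range Len then 1 else 0"])
  let ?N = "neighbours S i" and ?c = "\<lambda>v. if v = C j \<or> v \<in> range Len then 1 else 0 :: real"
  have card: "card (?N - {m}) + 1 = card ?N" if "m \<in> ?N" for m
    using card_Suc_Diff1[OF fin that] by simp
  have "total_degree (const (k {i, m}) * (var (Len {i, m}) - const (r {i, m})) *
      (var (C m) - var (C i)) * (\<Prod>m'\<in>?N - {m}. var (Len {i, m'})))
      \<le> 0 + 1 + 1 + card (?N - {m})" for m
    by (intro total_degree_mult_le total_degree_diff_le total_degree_prod_le) simp_all
  then show "total_degree (standard_force S k r C i) \<le> 1 + card ?N"
    unfolding standard_force_def
    by (intro total_degree_sum_le) (rule order.trans, assumption, use card in fastforce)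
  have Cm: "?c (C m) = (if m = j then 1 else 0)" for m
    using C by auto
  have "line_poly ?c (standard_force S k r C i) =
      (\<Sum>m\<in>?N. if m = j then smult (k {i, j}) ([:- r {i, j}, 1:] * monom 1 (card ?N)) else 0)"
    unfolding standard_force_def line_poly_sum
  proof (rule sum.cong)
    fix m assume m: "m \<in> ?N"
    \<comment> \<open>The coordinate difference supplies the factor x missing from the product of
      the other lengths.\<close>
    have "monom 1 (card ?N) = [:0, 1::real:] * [:0, 1:] ^ card (?N - {m})"
      using card[OF m] by (metis add.commute monom_altdef plus_1_eq_Suc power_Suc smult_1_left)
    then show "line_poly ?c (const (k {i, m}) * (var (Len {i, m}) - const (r {i, m})) *
      (var (C m) - var (C i)) * (\<Prod>m'\<in>?N - {m}. var (Len {i, m'}))) =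
      (if m = j then smult (k {i, j}) ([:- r {i, j}, 1:] * monom 1 (card ?N)) else 0)"
      using \<open>j \<noteq> i\<close> by (simp add: Cm smult_diff_right mult.commute)
  qed simp
  also have "\<dots> = smult (k {i, j}) ([:- r {i, j}, 1:] * monom 1 (card ?N))"
    using fin ne by simp
  also have "degree \<dots> = 1 + card ?N"
    using k by (simp add: degree_mult_eq degree_monom_eq del: mult_pCons_left mult_pCons_right)
  finally show "degree (line_poly ?c (standard_force S k r C i)) = 1 + card ?N" .
qed

lemma total_degree_inverse_force:
  assumes fin: "finite (neighbours S i)" and ne: "j \<in> neighbours S i" and "j \<noteq> i"
    and k: "k {i, j} \<noteq> 0" "r {i, j} \<noteq> 0" and C: "C \<in> {X, Y}"
  shows "total_degree (inverse_force S k r C i) = 2"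
\<comment> \<open>Again only the summand of \<open>j\<close> survives: k (1 - r x) x, with leading
  coefficient - k r.\<close>
proof (rule total_degree_eqI[where c = "\<lambda>v. if v = C j \<or> v \<in> range Inv then 1 else 0"])
  let ?N = "neighbours S i" and ?c = "\<lambda>v. if v = C j \<or> v \<in> range Inv then 1 else 0 :: real"
  have "total_degree (const (k {i, m}) * (1 - const (r {i, m}) * var (Inv {i, m})) *
      (var (C m) - var (C i))) \<le> 0 + (0 + 1) + 1" for m
    by (intro total_degree_mult_le total_degree_diff_le) simp_all
  then show "total_degree (inverse_force S k r C i) \<le> 2"
    unfolding inverse_force_def by (intro total_degree_sum_le) (simp add: numeral_2_eq_2)
  have Cm: "?c (C m) = (if m = j then 1 else 0)" for m
    using C by auto
  have "line_poly ?c (inverse_force S k r C i) =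
      (\<Sum>m\<in>?N. if m = j then [:0, k {i, j}, - (k {i, j} * r {i, j}):] else 0)"
    unfolding inverse_force_def line_poly_sum
    using \<open>j \<noteq> i\<close> by (intro sum.cong) (simp_all add: Cm one_pCons)
  then show "degree (line_poly ?c (inverse_force S k r C i)) = 2"
    using fin ne k by simp
qed


section \<open>Existence of equilibria\<close>

lemma inj_on_doubleton: "inj_on (\<lambda>j. {i, j}) A"
  by (auto simp: inj_on_def doubleton_eq_iff)

lemma incident_springs_eq:
  assumes "\<forall>e\<in>S. \<exists>i j. e = {i, j}"
  shows "{e \<in> S. i \<in> e} = (\<lambda>j. {i, j}) ` neighbours S i"
proof (intro equalityI subsetI)
  fix e assume e: "e \<in> {e \<in> S. i \<in> e}"
  then obtain a b where "e = {a, b}"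
    using assms by blast
  with e have "e = {i, a} \<or> e = {i, b}"
    by auto
  with e show "e \<in> (\<lambda>j. {i, j}) ` neighbours S i"
    by (auto simp: neighbours_def)
qed (auto simp: neighbours_def)

lemma num_incident_eq:
  assumes "\<forall>e\<in>S. \<exists>i j. e = {i, j}"
  shows "num_incident S i = card (neighbours S i)"
  unfolding num_incident_def incident_springs_eq[OF assms]
  by (rule card_image[OF inj_on_doubleton])

lemma finite_neighbours:
  assumes "finite S"
  shows "finite (neighbours S i)"
  using finite_vimageI[OF assms inj_on_doubleton[of i UNIV]]
  by (simp add: neighbours_def vimage_def)

lemma spring_network_pairs:
  assumes "spring_network n S k r"
  shows "\<forall>e\<in>S. \<exists>i j. e = {i, j}" and "finite S"
    and "j \<in> neighbours S i \<Longrightarrow> i \<in> {1..n} \<and> j \<in> {1..n} \<and> j \<noteq> i"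
proof -
  have sub: "S \<subseteq> {{i, j} | i j. 1 \<le> i \<and> i < j \<and> j \<le> n}"
    using assms by (simp add: spring_network_def)
  then show "\<forall>e\<in>S. \<exists>i j. e = {i, j}"
    by blast
  have "S \<subseteq> Pow {1..n}"
    using sub by force
  then show "finite S"
    by (rule finite_subset) simp
  assume "j \<in> neighbours S i"
  then have "{i, j} \<in> {{i, j} | i j. 1 \<le> i \<and> i < j \<and> j \<le> n}"
    using sub by (auto simp: neighbours_def)
  then show "i \<in> {1..n} \<and> j \<in> {1..n} \<and> j \<noteq> i"
    by (auto simp: doubleton_eq_iff)
qed

section \<open>The spring energy and its minimisers\<close>

text \<open>\<open>Min\<close> and \<open>Max\<close> recover the two endpoints from an unordered
  pair.\<close>

definition spring_length :: "(nat \<Rightarrow> 'a::metric_space) \<Rightarrow> nat set \<Rightarrow> real" where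
  "spring_length p e = dist (p (Min e)) (p (Max e))"

lemma spring_length_doubleton [simp]: "spring_length p {i, j} = dist (p i) (p j)"
  by (cases "i \<le> j") (auto simp: spring_length_def dist_commute min_def max_def)

text \<open>Twice the elastic energy of Hooke springs; the missing factor 1/2 does not affect
  minimisers.\<close>

definition energy ::
  "nat set set \<Rightarrow> (nat set \<Rightarrow> real) \<Rightarrow> (nat set \<Rightarrow> real) \<Rightarrow> (nat \<Rightarrow> 'a::metric_space) \<Rightarrow> real" where
  "energy S k r p = (\<Sum>e\<in>S. k e * (spring_length p e - r e)\<^sup>2)"

lemma continuous_on_energy:
  "continuous_on A (energy S k r :: (nat \<Rightarrow> 'a::metric_space) \<Rightarrow> real)"
proof -
  have "continuous_on UNIV (energy S k r :: (nat \<Rightarrow> 'a) \<Rightarrow> real)"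
    unfolding energy_def spring_length_def 
    by (intro continuous_on_sum continuous_on_mult continuous_on_const continuous_on_power
      continuous_on_diff continuous_on_dist continuous_on_product_coordinates)
  then show ?thesis
    by (rule continuous_on_subset) simp
qed

text \<open>Turns a bound on a square into a bound on the number without taking roots.\<close>

lemma le_one_plus_square: "x \<le> 1 + x\<^sup>2" for x :: real
  using zero_le_power2[of "x - 1", unfolded power2_diff, simplified] zero_le_power2[of x] by linarith

text \<open>All summands of the energy are nonnegative, so each one is at most
  \<open>E\<close>.\<close>

lemma ex_spring_length_bound:
  assumes "finite S" "e \<in> S" "\<forall>e\<in>S. 0 < k e"
  shows "\<exists>C. \<forall>p. energy S k r p \<le> E \<longrightarrow> spring_length p e \<le> C"
proof (intro exI allI impI)
  fix p :: "nat \<Rightarrow> 'a" assume "energy S k r p \<le> E"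
  moreover have "k e * (spring_length p e - r e)\<^sup>2 \<le> energy S k r p"
    unfolding energy_def using assms
    by (intro member_le_sum[where f = "\<lambda>e. k e * (spring_length p e - r e)\<^sup>2"]) (auto simp: less_imp_le)
  ultimately have "(spring_length p e - r e)\<^sup>2 \<le> E / k e"
    using assms by (simp add: pos_le_divide_eq mult.commute)
  moreover have "spring_length p e - r e \<le> 1 + (spring_length p e - r e)\<^sup>2"
    by (rule le_one_plus_square)
  ultimately show "spring_length p e \<le> r e + 1 + E / k e"
    by linarith
qed

text \<open>The energy is not coercive, but translating each connected component so that a chosen node of
  it sits at the origin confines the embeddings of bounded energy to a compact product of balls.\<close>

lemma ex_energy_minimizer:
  assumes S: "finite S" "\<forall>e\<in>S. \<exists>i j. e = {i, j}" and k: "\<forall>e\<in>S. 0 < k e"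
  shows "\<exists>p :: nat \<Rightarrow> 'a::euclidean_space. \<forall>q :: nat \<Rightarrow> 'a. energy S k r p \<le> energy S k r q"
proof -
  define T where "T = {(i, j). {i, j} \<in> S}"
  \<comment> \<open>The energy of the collapsed embedding, a competitor that will lie in the compact
    set; anything above \<open>E\<close> is irrelevant.\<close>
  define E where "E = energy S k r (\<lambda>_. 0 :: 'a)"
  define root where "root i = (SOME j. (i, j) \<in> T\<^sup>*)" for i
  have root: "(i, root i) \<in> T\<^sup>*" for i
    unfolding root_def by (rule someI[of _ i]) simp
  have symT: "sym (T\<^sup>*)"
    by (intro sym_rtrancl symI) (auto simp: T_def insert_commute)
  \<comment> \<open>Connected nodes reach the same nodes, so \<open>SOME\<close> is applied to the
    same predicate and yields one root per component.\<close>
  have root_eq: "root i = root j" if "{i, j} \<in> S" for i j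
  proof -
    have "(i, j) \<in> T\<^sup>*" "(j, i) \<in> T\<^sup>*"
      using that symT by (auto simp: T_def dest: symD)
    then have "(i, m) \<in> T\<^sup>* \<longleftrightarrow> (j, m) \<in> T\<^sup>*" for m
      by (meson rtrancl_trans)
    then show ?thesis
      by (simp add: root_def)
  qed
  \<comment> \<open>Spring lengths are bounded uniformly in \<open>p\<close>; the triangle
    inequality adds these bounds along a path of springs.\<close>
  have "\<exists>C. \<forall>p :: nat \<Rightarrow> 'a. energy S k r p \<le> E \<longrightarrow> dist (p i) (p j) \<le> C"
    if "(i, j) \<in> T\<^sup>*" for i j
    using that
  proof (induction rule: rtrancl_induct)
    case base
    show ?case by auto
  next
    case (step j m)
    obtain C where C: "\<forall>p :: nat \<Rightarrow> 'a. energy S k r p \<le> E \<longrightarrow> dist (p i) (p j) \<le> C"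
      using step by blast
    obtain D where D: "\<forall>p :: nat \<Rightarrow> 'a. energy S k r p \<le> E \<longrightarrow> spring_length p {j, m} \<le> D"
      using ex_spring_length_bound[OF S(1) _ k, of "{j, m}" r E] step(2) by (auto simp: T_def)
    have "dist (p i) (p m) \<le> C + D" if "energy S k r p \<le> E" for p :: "nat \<Rightarrow> 'a"
      using C D that dist_triangle[of "p i" "p m" "p j"] by fastforce
    then show ?case by blast
  qed
  then have "\<forall>i. \<exists>C. \<forall>p :: nat \<Rightarrow> 'a. energy S k r p \<le> E \<longrightarrow> dist (p i) (p (root i)) \<le> C"
    using root by blast
  from choice[OF this] obtain C where
    C: "\<And>i (p :: nat \<Rightarrow> 'a). energy S k r p \<le> E \<Longrightarrow> dist (p i) (p (root i)) \<le> C i"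
    by blast
  define K :: "(nat \<Rightarrow> 'a) set" where "K = (\<Pi>\<^sub>E i\<in>UNIV. cball 0 (C i))"
  \<comment> \<open>Tychonoff's theorem for closed balls of a Euclidean space.\<close>
  have "compactin (product_topology (\<lambda>_. euclidean) UNIV) K"
    unfolding K_def by (subst compactin_PiE) auto
  then have "compact K"
    by (simp add: euclidean_product_topology)
  have "0 \<le> C i" for i
    using C[of "\<lambda>_. 0" i] by (simp add: E_def)
  then have zero: "(\<lambda>_. 0) \<in> K"
    by (auto simp: K_def)
  with \<open>compact K\<close> obtain p where p: "p \<in> K" "\<forall>q\<in>K. energy S k r p \<le> energy S k r q"
    using continuous_attains_inf[OF _ _ continuous_on_energy[of K S k r]] by blast
  have "energy S k r p \<le> energy S k r q" for q :: "nat \<Rightarrow> 'a"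
  proof (cases "energy S k r q \<le> E")
    case True
    \<comment> \<open>Both ends of a spring share their root and move by the same vector, so no
      spring length changes.\<close>
    define q' where "q' i = q i - q (root i)" for i
    have "spring_length q' e = spring_length q e" if e: "e \<in> S" for e
    proof -
      obtain i j where ij: "e = {i, j}"
        using S e by blast
      then show ?thesis
        using root_eq[of i j] e by (simp add: q'_def dist_norm)
    qed
    then have "energy S k r q' = energy S k r q"
      by (simp add: energy_def)
    moreover have "q' \<in> K"
      using C[OF True] by (auto simp: K_def q'_def dist_norm norm_minus_commute)
    ultimately show ?thesis
      using p by metis
  next
    case False
    then show ?thesis
      using p zero by (force simp: E_def)
  qed
  then show ?thesis by blast
qed

section \<open>First-order condition at a minimiser\<close>

text \<open>Isolates the dependence on the position of one node. As \<open>i\<close> is not its own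
  neighbour, its neighbours stay in place.\<close>

lemma energy_update:
  assumes S: "finite S" "\<forall>e\<in>S. \<exists>i j. e = {i, j}" and "i \<notin> neighbours S i"
  shows "energy S k r (p(i := z)) = (\<Sum>j\<in>neighbours S i. k {i, j} * (dist z (p j) - r {i, j})\<^sup>2)
    + (\<Sum>e\<in>{e \<in> S. i \<notin> e}. k e * (spring_length p e - r e)\<^sup>2)"
proof -
  let ?f = "\<lambda>p e. k e * (spring_length p e - r e)\<^sup>2"
  have "energy S k r (p(i := z)) =
      sum (?f (p(i := z))) {e \<in> S. i \<in> e} + sum (?f (p(i := z))) {e \<in> S. i \<notin> e}"
    unfolding energy_def using S
    by (subst sum.union_disjoint[symmetric]) (auto intro: sum.cong)
  also have "sum (?f (p(i := z))) {e \<in> S. i \<in> e} =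
      (\<Sum>j\<in>neighbours S i. k {i, j} * (dist z (p j) - r {i, j})\<^sup>2)"
    unfolding incident_springs_eq[OF S(2)] sum.reindex[OF inj_on_doubleton]
    using assms(3) by (intro sum.cong) auto
  also have "sum (?f (p(i := z))) {e \<in> S. i \<notin> e} = sum (?f p) {e \<in> S. i \<notin> e}"
  proof (rule sum.cong)
    fix e assume e: "e \<in> {e \<in> S. i \<notin> e}"
    then obtain a b where "e = {a, b}"
      using S by blast
    then show "?f (p(i := z)) e = ?f p e"
      using e by auto
  qed simp
  finally show ?thesis .
qed

text \<open>The unit vector \<open>u\<close> replaces the gradient of the norm at \<open>a\<close>; at \<open>a = 0\<close> any unit vector is allowed.\<close>

lemma spring_energy_upper_bound:
  fixes a h u :: "'a::real_inner"
  assumes "norm u = 1" "u \<bullet> a = norm a" "0 \<le> c"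
  shows "(norm (a + h) - c)\<^sup>2 \<le> (norm a - c)\<^sup>2 + 2 * (h \<bullet> (a - c *\<^sub>R u)) + h \<bullet> h"
proof -
  \<comment> \<open>Cauchy-Schwarz makes \<open>u\<close> a subgradient of the norm at
    \<open>a\<close>. The norm enters the expanded square with factor - 2 \<open>c\<close>, so its
    lower bound gives an upper bound.\<close>
  have "u \<bullet> (a + h) \<le> norm (a + h)"
    using norm_cauchy_schwarz[of u "a + h"] assms by simp
  then have "c * (norm a + u \<bullet> h) \<le> c * norm (a + h)"
    using assms by (intro mult_left_mono) (simp_all add: inner_add_right)
  moreover have "(norm (a + h))\<^sup>2 = (norm a)\<^sup>2 + 2 * (h \<bullet> a) + h \<bullet> h"
    by (simp add: power2_norm_eq_inner inner_add_left inner_add_right inner_commute)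
  ultimately show ?thesis
    by (simp add: power2_diff inner_diff_right inner_commute algebra_simps)
qed

lemma sgn_inner_self: "sgn a \<bullet> a = norm a" for a :: "'a::real_inner"
  by (cases "a = 0") (simp_all add: sgn_div_norm dot_square_norm power2_eq_square)

text \<open>The sum is half the gradient of the energy in the position of node \<open>i\<close>.
  Were it nonzero, a step against it would lower the energy. At springs of length zero,
  \<open>u\<close> leaves the direction free.\<close>

lemma energy_minimizer_balance:
  fixes p :: "nat \<Rightarrow> 'a::real_inner"
  assumes S: "finite S" "\<forall>e\<in>S. \<exists>i j. e = {i, j}" and i: "i \<notin> neighbours S i"
    and kr: "\<forall>e\<in>S. 0 < k e \<and> 0 < r e"
    and min: "\<And>q :: nat \<Rightarrow> 'a. energy S k r p \<le> energy S k r q"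
    and u: "\<And>j. j \<in> neighbours S i \<Longrightarrow> norm (u j) = 1 \<and> u j \<bullet> (p i - p j) = dist (p i) (p j)"
  shows "(\<Sum>j\<in>neighbours S i. k {i, j} *\<^sub>R ((p i - p j) - r {i, j} *\<^sub>R u j)) = 0"
    (is "?G = 0")
proof (rule ccontr)
  assume G: "?G \<noteq> 0"
  let ?N = "neighbours S i"
  define c where "c = (\<Sum>j\<in>?N. k {i, j})"
  have kpos: "0 < k {i, j}" "0 < r {i, j}" if "j \<in> ?N" for j
    using that kr by (auto simp: neighbours_def)
  have "?N \<noteq> {}"
    using G by auto
  then have c: "0 < c"
    unfolding c_def using finite_neighbours[OF S(1)] kpos by (intro sum_pos) auto
  \<comment> \<open>The minimiser of the quadratic 2 (h \<bullet> G) + c (h \<bullet> h), whose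
    minimum is - (G \<bullet> G) / c.\<close>
  define h where "h = (- 1 / c) *\<^sub>R ?G"
  have "energy S k r p \<le> energy S k r (p(i := p i + h))"
    by (rule min)
  moreover have "energy S k r p = energy S k r (p(i := p i))"
    by simp
  ultimately have "(\<Sum>j\<in>?N. k {i, j} * (dist (p i) (p j) - r {i, j})\<^sup>2)
      \<le> (\<Sum>j\<in>?N. k {i, j} * (dist (p i + h) (p j) - r {i, j})\<^sup>2)"
    unfolding energy_update[OF S i] by linarith
  also have "\<dots> \<le> (\<Sum>j\<in>?N. k {i, j} * ((dist (p i) (p j) - r {i, j})\<^sup>2
      + 2 * (h \<bullet> ((p i - p j) - r {i, j} *\<^sub>R u j)) + h \<bullet> h))"
  proof (intro sum_mono mult_left_mono)
    fix j assume j: "j \<in> ?N"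
    show "(dist (p i + h) (p j) - r {i, j})\<^sup>2 \<le> (dist (p i) (p j) - r {i, j})\<^sup>2
      + 2 * (h \<bullet> ((p i - p j) - r {i, j} *\<^sub>R u j)) + h \<bullet> h"
      using spring_energy_upper_bound[of "u j" "p i - p j" "r {i, j}" h] u[OF j] kpos[OF j]
      by (simp add: dist_norm algebra_simps)
  qed (use kpos in force)
  also have "\<dots> = (\<Sum>j\<in>?N. k {i, j} * (dist (p i) (p j) - r {i, j})\<^sup>2) + 2 * (h \<bullet> ?G) + c * (h \<bullet> h)"
    by (simp add: c_def sum.distrib distrib_left inner_sum_right sum_distrib_left sum_distrib_right mult_ac)
  finally have "0 \<le> 2 * (h \<bullet> ?G) + c * (h \<bullet> h)"
    by simp
  also have "\<dots> = - (?G \<bullet> ?G) / c"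
    using c by (simp add: h_def field_simps)
  finally show False
    using divide_pos_pos[OF _ c, of "?G \<bullet> ?G"] G by (simp del: zero_less_divide_iff)
qed

lemma eq_neg_self: "v = - v \<Longrightarrow> v = 0" for v :: "'a::real_vector"
  using scaleR_2[of v] by (simp add: eq_neg_iff_add_eq_0)

text \<open>Two coinciding endpoints of a spring allow both a unit vector and its negative in the balance
  equation, which cannot hold for both.\<close>

lemma energy_minimizer_dist_nonzero:
  fixes p :: "nat \<Rightarrow> 'a::euclidean_space"
  assumes S: "finite S" "\<forall>e\<in>S. \<exists>i j. e = {i, j}" and i: "i \<notin> neighbours S i"
    and kr: "\<forall>e\<in>S. 0 < k e \<and> 0 < r e"
    and min: "\<And>q :: nat \<Rightarrow> 'a. energy S k r p \<le> energy S k r q"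
    and m: "m \<in> neighbours S i"
  shows "p i \<noteq> p m"
proof
  assume eq: "p i = p m"
  obtain b :: 'a where "b \<in> Basis"
    using nonempty_Basis by blast
  define u where "u j = (if p i = p j then b else sgn (p i - p j))" for j
  have u: "norm (u j) = 1 \<and> u j \<bullet> (p i - p j) = dist (p i) (p j)" for j
  proof (cases "p i = p j")
    case True
    then show ?thesis
      using \<open>b \<in> Basis\<close> by (simp add: u_def)
  next
    case False
    then show ?thesis
      by (simp add: u_def norm_sgn sgn_inner_self dist_norm)
  qed
  \<comment> \<open>Flipping the sign at \<open>m\<close> is admissible because
    \<open>p i - p m\<close> vanishes.\<close>
  define w where "w = u(m := - b)"
  have w: "norm (w j) = 1 \<and> w j \<bullet> (p i - p j) = dist (p i) (p j)" for j
    using u[of j] eq \<open>b \<in> Basis\<close> by (simp add: w_def)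
  let ?F = "\<lambda>u j. k {i, j} *\<^sub>R ((p i - p j) - r {i, j} *\<^sub>R u j)"
  have remove: "sum (?F v) (neighbours S i) = ?F v m + sum (?F v) (neighbours S i - {m})" for v
    by (rule sum.remove[OF finite_neighbours[OF S(1)] m])
  have rest: "sum (?F u) (neighbours S i - {m}) = sum (?F w) (neighbours S i - {m})"
    by (rule sum.cong) (simp_all add: w_def)
  have "sum (?F u) (neighbours S i) = 0"
    by (rule energy_minimizer_balance[OF S i kr min u])
  moreover have "sum (?F w) (neighbours S i) = 0"
    by (rule energy_minimizer_balance[OF S i kr min w])
  \<comment> \<open>The two balances differ only in the summand of \<open>m\<close>.\<close>
  ultimately have "?F u m = ?F w m"
    unfolding remove rest by (rule add_right_imp_eq[OF trans[OF _ sym]])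
  moreover have "u m = b" "w m = - b"
    using eq by (simp_all add: u_def w_def)
  ultimately have "(k {i, m} * r {i, m}) *\<^sub>R b = - ((k {i, m} * r {i, m}) *\<^sub>R b)"
    using eq by simp
  then have "(k {i, m} * r {i, m}) *\<^sub>R b = 0"
    by (rule eq_neg_self)
  moreover have "0 < k {i, m} \<and> 0 < r {i, m}"
    using kr m by (simp add: neighbours_def)
  ultimately show False
    using \<open>b \<in> Basis\<close> by simp
qed

text \<open>A global energy minimiser has no spring of length zero, so its balance with
  \<open>sgn (p i - p j)\<close> as unit vectors is the force balance up to sign.\<close>

lemma equilibria_nonempty:
  assumes N: "spring_network n S k r"
  shows "equilibria n S k r \<noteq> {}"
proof -
  note S = spring_network_pairs(2,1)[OF N] and nb = spring_network_pairs(3)[OF N]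
  have kr: "\<forall>e\<in>S. 0 < k e \<and> 0 < r e"
    using N by (simp add: spring_network_def)
  obtain p :: "nat \<Rightarrow> real^2" where min: "\<And>q :: nat \<Rightarrow> real^2. energy S k r p \<le> energy S k r q"
    using ex_energy_minimizer[OF S, of k r] kr by blast
  have i: "i \<notin> neighbours S i" for i
    using nb by blast
  have ne: "p i \<noteq> p j" if "j \<in> neighbours S i" for i j
    using energy_minimizer_dist_nonzero[OF S i kr min that] .
  have "(\<Sum>j\<in>neighbours S i. spring_force k r p i j) = 0" for i
  proof -
    have "(\<Sum>j\<in>neighbours S i. k {i, j} *\<^sub>R ((p i - p j) - r {i, j} *\<^sub>R sgn (p i - p j))) = 0"
      by (rule energy_minimizer_balance[OF S i kr min])
        (use ne in \<open>simp add: norm_sgn sgn_inner_self dist_norm\<close>)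
    moreover have "k {i, j} *\<^sub>R ((p i - p j) - r {i, j} *\<^sub>R sgn (p i - p j)) = - spring_force k r p i j"
      if "j \<in> neighbours S i" for j
    proof -
      have "k {i, j} *\<^sub>R ((p i - p j) - r {i, j} *\<^sub>R sgn (p i - p j)) =
          (k {i, j} * (1 - r {i, j} / dist (p i) (p j))) *\<^sub>R (p i - p j)"
        by (simp add: sgn_div_norm dist_norm algebra_simps divide_inverse)
      also have "1 - r {i, j} / dist (p i) (p j) = (dist (p i) (p j) - r {i, j}) * (1 / dist (p i) (p j))"
        using ne[OF that] by (simp add: field_simps)
      finally show ?thesis
        by (simp add: spring_force_def mult.assoc flip: scaleR_minus_right)
    qed
    ultimately show ?thesis
      by (simp add: sum_negf)
  qed
  moreover have "spring_force k r (restrict p {1..n}) i j = spring_force k r p i j"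
    if "j \<in> neighbours S i" for i j
    using nb[OF that] by (simp add: spring_force_def)
  \<comment> \<open>The minimiser lives on all labels, whereas equilibria are extensional on the
    nodes; every spring joins two nodes.\<close>
  ultimately have "restrict p {1..n} \<in> equilibria n S k r"
    using ne nb by (fastforce simp: equilibria_def)
  then show ?thesis by blast
qed

section \<open>Rigidity excludes isolated nodes\<close>

text \<open>Rotations preserve the norm and translations cancel in differences. This invariant tells
  equilibria apart up to motion.\<close>

lemma rigid_motion_rel_dist:
  assumes "(p, q) \<in> rigid_motion_rel n" "i \<in> {1..n}" "j \<in> {1..n}"
  shows "dist (q i) (q j) = dist (p i) (p j)"
proof -
  obtain A :: "real^2^2" and t where A: "rotation_matrix A" "\<forall>i\<in>{1..n}. q i = A *v p i + t"
    using assms(1) by (auto simp: rigid_motion_rel_def)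
  then have "orthogonal_transformation ((*v) A)"
    by (simp add: rotation_matrix_def orthogonal_transformation_matrix)
  then show ?thesis
    using A(2) assms(2,3)
    by (simp add: dist_norm orthogonal_transformation_norm flip: matrix_vector_mult_diff_distrib)
qed

lemma rigid_network_no_isolated_node:
  assumes N: "spring_network n S k r" and rigid: "rigid_network n S k r" and i: "i \<in> {1..n}"
  shows "neighbours S i \<noteq> {}"
proof
  assume iso: "neighbours S i = {}"
  note nb = spring_network_pairs(3)[OF N]
  obtain p where p: "p \<in> equilibria n S k r"
    using equilibria_nonempty[OF N] by blast
  have "2 \<le> n"
    using N by (simp add: spring_network_def)
  then obtain j where j: "j \<in> {1..n}" "j \<noteq> i"
    by (cases "i = 1") (auto intro: that[of 1] that[of 2])
  \<comment> \<open>Places the isolated node at distance |t| from node \<open>j\<close>; restricting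
    to t \<ge> 0 makes this distance determine t.\<close>
  define q where "q t = p(i := p j + t *\<^sub>R axis 1 1)" for t :: real
  let ?R = "rigid_motion_rel n \<inter> equilibria n S k r \<times> equilibria n S k r"
  have i_nb: "i \<notin> neighbours S m" for m
    using iso by (auto simp: neighbours_def insert_commute)
  have q: "q t \<in> equilibria n S k r" for t
    unfolding equilibria_def
  proof (intro CollectI conjI ballI)
    show "q t \<in> {1..n} \<rightarrow>\<^sub>E UNIV"
      using p i by (auto simp: q_def equilibria_def PiE_def extensional_def)
    fix m assume m: "m \<in> {1..n}"
    \<comment> \<open>Neither a neighbour of any node nor a node with neighbours can be
      \<open>i\<close>, so no force sees the displacement.\<close>
    have same: "q t a = p a" if "a \<in> neighbours S m \<or> a = m \<and> neighbours S m \<noteq> {}" for a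
      using that i_nb iso by (auto simp: q_def)
    have at: "q t m = p m" "q t a = p a" if "a \<in> neighbours S m" for a
      using same that by blast+
    then have "spring_force k r (q t) m a = spring_force k r p m a" if "a \<in> neighbours S m" for a
      using that by (simp add: spring_force_def)
    then show "(\<Sum>a\<in>neighbours S m. spring_force k r (q t) m a) = 0"
      using p m by (simp add: equilibria_def)
    show "dist (q t m) (q t a) \<noteq> 0" if "a \<in> neighbours S m" for a
      using p m that at[OF that] by (auto simp: equilibria_def)
  qed
  \<comment> \<open>The identity motion puts \<open>q t\<close> into its own image, so equal images
    make \<open>q s\<close> and \<open>q t\<close> related.\<close>
  have refl: "(q t, q t) \<in> ?R" for t
  proof -
    have "rotation_matrix (mat 1 :: real^2^2)"
      by (simp add: rotation_matrix_def orthogonal_matrix_id)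
    moreover have "\<forall>m\<in>{1..n}. q t m = mat 1 *v q t m + 0"
      by simp
    ultimately have "(q t, q t) \<in> rigid_motion_rel n"
      unfolding rigid_motion_rel_def by blast
    with q show ?thesis
      by blast
  qed
  have "inj_on (\<lambda>t. ?R `` {q t}) {0..}"
  proof (rule inj_onI)
    fix s t :: real assume st: "s \<in> {0..}" "t \<in> {0..}" "?R `` {q s} = ?R `` {q t}"
    then have "(q s, q t) \<in> rigid_motion_rel n"
      using refl[of t] by blast
    from rigid_motion_rel_dist[OF this i j(1)] show "s = t"
      using st j(2) by (simp add: q_def dist_norm norm_axis_1)
  qed
  moreover have "(\<lambda>t. ?R `` {q t}) ` {0..} \<subseteq> equilibria n S k r // ?R"
    using q by (auto simp: quotient_def)
  ultimately have "finite {0::real..}"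
    using rigid unfolding rigid_network_def by (metis finite_imageD finite_subset)
  then show False
    using infinite_Ici by blast
qed


section \<open>The Bezout bounds\<close>

text \<open>The inequality of arithmetic and geometric means, raised to the power
  \<open>card A\<close> to remove the root.\<close>

lemma prod_le_mean_power:
  fixes f :: "'a \<Rightarrow> real"
  assumes "finite A" "A \<noteq> {}" "\<And>i. i \<in> A \<Longrightarrow> 0 \<le> f i"
  shows "(\<Prod>i\<in>A. f i) \<le> ((\<Sum>i\<in>A. f i) / card A) ^ card A"
proof -
  have card: "0 < card A"
    using assms by (simp add: card_gt_0_iff)
  have P: "0 \<le> (\<Prod>i\<in>A. f i)"
    using assms(3) by (rule prod_nonneg)
  have "(\<Prod>i\<in>A. f i) = ((\<Prod>i\<in>A. f i) powr (1 / card A)) ^ card A"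
    using P card by (subst powr_realpow'[symmetric]) (simp_all add: powr_powr)
  also have "\<dots> \<le> (\<Sum>i\<in>A. f i / card A) ^ card A"
    by (intro power_mono arith_geom_mean assms) simp_all
  finally show ?thesis
    by (simp add: sum_divide_distrib)
qed

text \<open>Double counting of incidences: every spring has exactly two ends.\<close>

lemma sum_num_incident:
  assumes N: "spring_network n S k r"
  shows "(\<Sum>i=1..n. num_incident S i) = 2 * card S"
  unfolding num_incident_def
proof (rule sum_multicount)
  show "\<forall>e\<in>S. card {i \<in> {1..n}. i \<in> e} = 2"
  proof
    fix e assume "e \<in> S"
    then obtain i j where e: "e = {i, j}" "1 \<le> i" "i < j" "j \<le> n"
      using N by (auto simp: spring_network_def)
    then have "{a \<in> {1..n}. a \<in> e} = {i, j}"
      by auto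
    with e show "card {a \<in> {1..n}. a \<in> e} = 2"
      by simp
  qed
qed (use spring_network_pairs[OF N] in auto)

text \<open>The geometric equations are indexed by ordered pairs; this makes their number
  \<open>card S\<close>.\<close>

lemma ordered_springs_bij:
  assumes N: "spring_network n S k r"
  shows "bij_betw (\<lambda>(i, j). {i, j}) (ordered_springs S) S"
proof (rule bij_betw_imageI)
  show "inj_on (\<lambda>(i, j). {i, j}) (ordered_springs S)"
    by (auto simp: inj_on_def ordered_springs_def doubleton_eq_iff)
  show "(\<lambda>(i, j). {i, j}) ` ordered_springs S = S"
  proof (intro equalityI subsetI)
    fix e assume "e \<in> S"
    moreover obtain i j where "e = {i, j}" "i < j"
      using N \<open>e \<in> S\<close> by (auto simp: spring_network_def)
    ultimately show "e \<in> (\<lambda>(i, j). {i, j}) ` ordered_springs S"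
      by (intro image_eqI[of _ _ "(i, j)"]) (simp_all add: ordered_springs_def)
  qed (auto simp: ordered_springs_def)
qed

lemma bezout_bound_add [simp]: "bezout_bound (F + G) = bezout_bound F * bezout_bound G"
  by (simp add: bezout_bound_def)

text \<open>The product runs over indices, so equal polynomials from different indices keep their
  multiplicity.\<close>

lemma bezout_bound_mset_set:
  "bezout_bound {#f i. i \<in># mset_set A#} = (\<Prod>i\<in>A. total_degree (f i))"
  by (simp add: bezout_bound_def prod_unfold_prod_mset multiset.map_comp comp_def)

theorem theorem2p3:
  fixes n s :: nat and S :: "nat set set" and k r :: "nat set \<Rightarrow> real"
  assumes "spring_network n S k r"
    and "rigid_network n S k r"
    and "s = card S"
  shows "bezout_bound (standard_system n S k r) = 2 ^ s * (\<Prod>j=1..n. (1 + num_incident S j)\<^sup>2)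
    \<and> real (2 ^ s * (\<Prod>j=1..n. (1 + num_incident S j)\<^sup>2))
        \<le> 2 ^ s * (1 + 2 * real s / real n) ^ (2 * n)
    \<and> bezout_bound (inverse_length_system n S k r) = 4 ^ s * 4 ^ n
    \<and> (4 ^ s * 4 ^ n :: nat) = 2 ^ (2 * s + 2 * n)"
proof (intro conjI)
  note N = assms(1)
  note pairs = spring_network_pairs(1)[OF N]
    and fin = finite_neighbours[OF spring_network_pairs(2)[OF N]]
  have card_springs: "card (ordered_springs S) = s"
    using bij_betw_same_card[OF ordered_springs_bij[OF N]] assms(3) by simp
  have n: "2 \<le> n"
    using N by (simp add: spring_network_def)
  \<comment> \<open>Rigidity enters here: it provides a neighbour of every node, which makes the
    force polynomials attain their expected degrees.\<close>
  have force: "total_degree (standard_force S k r C i) = 1 + num_incident S i"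
    "total_degree (inverse_force S k r C i) = 2"
    if i: "i \<in> {1..n}" and C: "C \<in> {X, Y}" for C i
  proof -
    obtain j where j: "j \<in> neighbours S i"
      using rigid_network_no_isolated_node[OF N assms(2) i] by blast
    then have "j \<noteq> i" and "0 < k {i, j} \<and> 0 < r {i, j}"
      using spring_network_pairs(3)[OF N j] N by (auto simp: spring_network_def neighbours_def)
    then show "total_degree (standard_force S k r C i) = 1 + num_incident S i"
      "total_degree (inverse_force S k r C i) = 2"
      using total_degree_standard_force[OF fin j _ _ C] total_degree_inverse_force[OF fin j _ _ _ C]
      by (simp_all add: num_incident_eq[OF pairs])
  qed
  have standard: "(\<Prod>i=1..n. total_degree (standard_force S k r C i)) =
      (\<Prod>i=1..n. 1 + num_incident S i)" if "C \<in> {X, Y}" for C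
    using force(1) that by (intro prod.cong) auto
  have inverse: "(\<Prod>i=1..n. total_degree (inverse_force S k r C i)) = 2 ^ n" if "C \<in> {X, Y}" for C
    using force(2) that by simp
  have "(\<Prod>(i, j)\<in>ordered_springs S. total_degree (sq_dist_poly i j - (var (Len {i, j}))\<^sup>2)) =
      (\<Prod>_\<in>ordered_springs S. 2)"
    by (rule prod.cong) (auto simp: ordered_springs_def total_degree_standard_geometric)
  \<comment> \<open>One product comes from the x-coordinates and one from the y-coordinates, hence
    the squares.\<close>
  then have "bezout_bound (standard_system n S k r) =
      2 ^ s * (\<Prod>j=1..n. 1 + num_incident S j) * (\<Prod>j=1..n. 1 + num_incident S j)"
    unfolding standard_system_def bezout_bound_add bezout_bound_mset_set
    by (simp add: case_prod_unfold standard[simplified] card_springs)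
  then show "bezout_bound (standard_system n S k r) =
      2 ^ s * (\<Prod>j=1..n. (1 + num_incident S j)\<^sup>2)"
    by (simp only: power2_eq_square prod.distrib mult.assoc)
  have "(\<Prod>(i, j)\<in>ordered_springs S. total_degree (sq_dist_poly i j * (var (Inv {i, j}))\<^sup>2 - 1)) =
      (\<Prod>_\<in>ordered_springs S. 4)"
    by (rule prod.cong) (auto simp: ordered_springs_def total_degree_inverse_geometric)
  then have "bezout_bound (inverse_length_system n S k r) = 4 ^ s * 2 ^ n * 2 ^ n"
    unfolding inverse_length_system_def bezout_bound_add bezout_bound_mset_set
    by (simp add: case_prod_unfold inverse[simplified] card_springs)
  then show "bezout_bound (inverse_length_system n S k r) = 4 ^ s * 4 ^ n"
    by (simp add: mult.assoc flip: power_mult_distrib)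
  show "(4 ^ s * 4 ^ n :: nat) = 2 ^ (2 * s + 2 * n)"
    by (simp add: power_add power_mult)
  have "(\<Prod>j=1..n. 1 + real (num_incident S j))
      \<le> ((\<Sum>j=1..n. 1 + real (num_incident S j)) / card {1..n}) ^ card {1..n}"
    using n by (intro prod_le_mean_power) simp_all
  also have "(\<Sum>j=1..n. 1 + real (num_incident S j)) = n + 2 * s"
    using sum_num_incident[OF N] assms(3)
    by (simp add: sum.distrib flip: of_nat_sum)
  finally have "(\<Prod>j=1..n. 1 + real (num_incident S j)) \<le> (1 + 2 * s / n) ^ n"
    using n by (simp add: add_divide_distrib)
  then have "(\<Prod>j=1..n. 1 + real (num_incident S j))\<^sup>2 \<le> ((1 + 2 * s / n) ^ n)\<^sup>2"
    by (rule power_mono) (simp add: prod_nonneg)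
  then show "real (2 ^ s * (\<Prod>j=1..n. (1 + num_incident S j)\<^sup>2))
      \<le> 2 ^ s * (1 + 2 * real s / real n) ^ (2 * n)"
    by (simp add: prod_power_distrib mult.commute[of 2 n] power_mult)
qed

end
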